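(* Let $\alpha=\{\alpha_n\}_{n=0}^\infty$ be a strictly increasing (bounded, positive) weight sequence such that the unilateral weighted shift $W_\alpha$ is $2$-hyponormal. Then $W_\alpha$ remains positively quadratically hyponormal under small nonzero finite rank perturbations of $\alpha$; that is, for every $N\ge 0$ there exists $\delta>0$ such that for every sequence of positive numbers $\alpha'=\{\alpha'_n\}_{n=0}^\infty$ with $\alpha'\ne\alpha$, $\alpha'_n=\alpha_n$ for all $n>N$ and $|\alpha'_n-\alpha_n|<\delta$ for $0\le n\le N$, the weighted shift $W_{\alpha'}$ is positively quadratically hyponormal.
   Context: For a bounded sequence of positive numbers $\alpha=\{\alpha_n\}_{n\ge 0}$, the unilateral weighted shift $W_\alpha$ on $\ell^2(\mathbb{Z}_+)$ is defined by $W_\alpha e_n=\alpha_n e_{n+1}$, with $\{e_n\}$ the canonical orthonormal basis. Write $[A,B]=AB-BA$. An operator $T$ is $k$-hyponormal if the $k\times k$ operator matrix $([T^{*j},T^i])_{i,j=1}^k$ is positive (semidefinite). For $s\in\mathbb{C}$ let $D_n(s)=P_n[(W_\alpha+sW_\alpha^2)^*,\,W_\alpha+sW_\alpha^2]P_n$, regarded as an $(n+1)\times(n+1)$ matrix, where $P_n$ is the orthogonal projection onto the span of $e_0,\dots,e_n$. With $\alpha_{-2}=\alpha_{-1}=0$, $u_n=\alpha_n^2-\alpha_{n-1}^2$, $v_n=\alpha_n^2\alpha_{n+1}^2-\alpha_{n-1}^2\alpha_{n-2}^2$, $w_n=\alpha_n^2(\alpha_{n+1}^2-\alpha_{n-1}^2)^2$,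 and $\alpha$ nondecreasing, this matrix is tridiagonal with diagonal entries $u_m+|s|^2v_m$ ($0\le m\le n$), subdiagonal entries $s\sqrt{w_m}$ and superdiagonal entries $\bar s\sqrt{w_m}$ ($0\le m\le n-1$). Its determinant is a polynomial of degree at most $n+1$ in $t=|s|^2$; write $\det D_n(s)=\sum_{i=0}^{n+1}c(n,i)t^i$. The shift $W_\alpha$ is called positively quadratically hyponormal if $c(n,i)\ge 0$ for all $n\ge 0$ and $0\le i\le n+1$ (the coefficients being computed from the weights of the shift in question). *)

theory Defs
  imports Complex_Main "HOL-Library.Nonpos_Ints" "Jordan_Normal_Form.Determinant"
begin

text \<open>
  Vectors of \<open>\<ell>\<^sup>2(\<int>\<^sub>+)\<close> are square-summable functions \<open>nat \<Rightarrow> complex\<close>. Operators are represented by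
  functions on all of \<open>nat \<Rightarrow> complex\<close>; only their values on \<open>ell2\<close> matter.
\<close>

type_synonym seqop = "(nat \<Rightarrow> complex) \<Rightarrow> (nat \<Rightarrow> complex)"

definition ell2 :: "(nat \<Rightarrow> complex) set" where
  "ell2 = {x. summable (\<lambda>n. (cmod (x n))\<^sup>2)}"

definition ell2_inner :: "(nat \<Rightarrow> complex) \<Rightarrow> (nat \<Rightarrow> complex) \<Rightarrow> complex" where
  "ell2_inner x y = (\<Sum>n. x n * cnj (y n))"

definition ell2_basis :: "nat \<Rightarrow> (nat \<Rightarrow> complex)" where
  "ell2_basis n = (\<lambda>k. if k = n then 1 else 0)"

definition ell2_adjoint :: "seqop \<Rightarrow> seqop" where
  "ell2_adjoint T y =
     (THE z. z \<in> ell2 \<and> (\<forall>x\<in>ell2. ell2_inner (T x) y = ell2_inner x z))"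

definition commutator :: "seqop \<Rightarrow> seqop \<Rightarrow> seqop" where
  "commutator A B x = (\<lambda>n. A (B x) n - B (A x) n)"

text \<open>
  Positivity of the operator matrix \<open>([T\<^sup>*\<^sup>j, T\<^sup>i])\<close> with row index \<open>i\<close> and column index \<open>j\<close>, acting on
  the direct sum of \<open>k\<close> copies of \<open>\<ell>\<^sup>2\<close>: its quadratic form is real and nonnegative.
\<close>

definition k_hyponormal :: "nat \<Rightarrow> seqop \<Rightarrow> bool" where
  "k_hyponormal k T \<longleftrightarrow>
     (\<forall>x :: nat \<Rightarrow> (nat \<Rightarrow> complex). (\<forall>i\<in>{1..k}. x i \<in> ell2) \<longrightarrow>
        (\<Sum>i=1..k. \<Sum>j=1..k.
           ell2_inner (commutator (ell2_adjoint T ^^ j) (T ^^ i) (x j)) (x i)) \<in> \<real>\<^sub>\<ge>\<^sub>0)"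

definition weighted_shift :: "(nat \<Rightarrow> real) \<Rightarrow> seqop" where
  "weighted_shift \<alpha> x = (\<lambda>n. case n of 0 \<Rightarrow> 0 | Suc m \<Rightarrow> complex_of_real (\<alpha> m) * x m)"

lemma weighted_shift_basis:
  "weighted_shift \<alpha> (ell2_basis n) = (\<lambda>k. complex_of_real (\<alpha> n) * ell2_basis (Suc n) k)"
  by (auto simp: weighted_shift_def ell2_basis_def fun_eq_iff split: nat.splits)

definition shift_pencil :: "(nat \<Rightarrow> real) \<Rightarrow> complex \<Rightarrow> seqop" where
  "shift_pencil \<alpha> s x =
     (\<lambda>n. weighted_shift \<alpha> x n + s * weighted_shift \<alpha> (weighted_shift \<alpha> x) n)"

definition basis_proj :: "nat \<Rightarrow> seqop" where
  "basis_proj n x = (\<lambda>k. if k \<le> n then x k else 0)"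

definition Dmat :: "(nat \<Rightarrow> real) \<Rightarrow> nat \<Rightarrow> complex \<Rightarrow> complex mat" where
  "Dmat \<alpha> n s =
     (let T = shift_pencil \<alpha> s; C = commutator (ell2_adjoint T) T
      in mat (n + 1) (n + 1) (\<lambda>(i, j).
           ell2_inner (basis_proj n (C (basis_proj n (ell2_basis j)))) (ell2_basis i)))"

text \<open>
  The coefficients \<open>c 0, \<dots>, c (n + 1)\<close> below are uniquely determined by the identity for all \<open>s\<close>,
  since \<open>\<bar>s\<bar>\<^sup>2\<close> takes infinitely many values.
\<close>

definition positively_quadratically_hyponormal :: "(nat \<Rightarrow> real) \<Rightarrow> bool" where
  "positively_quadratically_hyponormal \<alpha> \<longleftrightarrow>
     (\<forall>n. \<exists>c :: nat \<Rightarrow> real.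
        (\<forall>s. det (Dmat \<alpha> n s) = complex_of_real (\<Sum>i\<le>n + 1. c i * ((cmod s)\<^sup>2) ^ i)) \<and>
        (\<forall>i\<le>n + 1. 0 \<le> c i))"

end

theory Submission
  imports Defs
begin

text \<open>
  Write \<open>u\<^sub>n\<close>, \<open>v\<^sub>n\<close>, \<open>w\<^sub>n\<close> for the entries of the tridiagonal matrix \<open>D\<^sub>n(s)\<close>, \<open>t = \<bar>s\<bar>\<^sup>2\<close>, and \<open>d\<^sub>n(t)\<close>
  for the determinant of its leading \<open>n \<times> n\<close> block. Put \<open>e\<^sub>n = d\<^sub>n\<^sub>+\<^sub>1 - u\<^sub>n d\<^sub>n\<close>. The three-term
  recursion becomes \<open>e\<^sub>n\<^sub>+\<^sub>1 = t (v\<^sub>n\<^sub>+\<^sub>1 e\<^sub>n + (u\<^sub>n v\<^sub>n\<^sub>+\<^sub>1 - w\<^sub>n) d\<^sub>n)\<close>, and 2-hyponormality gives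
  \<open>w\<^sub>n \<le> u\<^sub>n v\<^sub>n\<^sub>+\<^sub>1\<close>. Hence \<open>d\<^sub>n\<close> and \<open>e\<^sub>n\<close> have nonnegative coefficients; those of \<open>d\<^sub>n\<close> of
  degree at most \<open>n\<close> and the top one of \<open>e\<^sub>n\<close> are positive.

  A perturbation of the weights \<open>\<alpha>\<^sub>0, \<dots>, \<alpha>\<^sub>N\<close> leaves the recursion unchanged from \<open>M = N + 2\<close> on. By
  continuity it keeps the coefficients of \<open>d\<^sub>n\<close> positive for \<open>n \<le> M + 1\<close>, but the lower coefficients
  of \<open>e\<^sub>M\<close>, which may vanish for \<open>\<alpha>\<close>, can become slightly negative. Their
  contribution to later determinants is dominated by that of the top coefficient, uniformly in
  \<open>n\<close>, because \<open>v\<^sub>n / u\<^sub>n\<close> is bounded. The bound comes from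
  rewriting \<open>w\<^sub>n \<le> u\<^sub>n v\<^sub>n\<^sub>+\<^sub>1\<close> as the monotonicity of
  \<open>\<alpha>\<^sub>n\<^sub>-\<^sub>1\<^sup>2 \<alpha>\<^sub>n\<^sup>2 u\<^sub>n\<^sub>+\<^sub>1 / u\<^sub>n\<close>: this quantity stays bounded, as otherwise the increments \<open>u\<^sub>n\<close> of the
  bounded sequence \<open>\<alpha>\<^sub>n\<^sup>2\<close> would eventually be nondecreasing.
\<close>

section \<open>Determinants of tridiagonal matrices\<close>

text \<open>Expansion along the last row meets two nonzero entries; the minor of the off-diagonal
  one has a last column supported in its bottom entry.\<close>

lemma det_tridiagonal:
  fixes f :: "nat \<Rightarrow> nat \<Rightarrow> 'a :: comm_ring_1"
  assumes f: "\<And>i j. Suc i < j \<or> Suc j < i \<Longrightarrow> f i j = 0"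
  shows "det (mat (Suc (Suc n)) (Suc (Suc n)) (\<lambda>(i, j). f i j)) =
    f (Suc n) (Suc n) * det (mat (Suc n) (Suc n) (\<lambda>(i, j). f i j))
    - f (Suc n) n * f n (Suc n) * det (mat n n (\<lambda>(i, j). f i j))"
proof -
  let ?A = "\<lambda>n. mat n n (\<lambda>(i, j). f i j)"
  let ?B = "mat_delete (?A (Suc (Suc n))) (Suc n) n"
  have "det (?A (Suc (Suc n))) =
      (\<Sum>j<Suc (Suc n). ?A (Suc (Suc n)) $$ (Suc n, j) * cofactor (?A (Suc (Suc n))) (Suc n) j)"
    by (rule laplace_expansion_row) auto
  also have "\<dots> = f (Suc n) n * cofactor (?A (Suc (Suc n))) (Suc n) n
      + f (Suc n) (Suc n) * cofactor (?A (Suc (Suc n))) (Suc n) (Suc n)"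
    using f by simp
  also have "cofactor (?A (Suc (Suc n))) (Suc n) (Suc n) = det (?A (Suc n))"
    by (auto simp: cofactor_def mat_delete_def intro!: arg_cong[where f = det] eq_matI)
  also have "cofactor (?A (Suc (Suc n))) (Suc n) n = - det ?B"
    by (simp add: cofactor_def)
  also have "det ?B = (\<Sum>i<Suc n. ?B $$ (i, n) * cofactor ?B i n)"
    by (rule laplace_expansion_column) (auto simp: mat_delete_def)
  also have "\<dots> = f n (Suc n) * cofactor ?B n n"
    using f by (simp add: mat_delete_def)
  also have "cofactor ?B n n = det (?A n)"
    by (auto simp: cofactor_def mat_delete_def intro!: arg_cong[where f = det] eq_matI)
  finally show ?thesis by (simp add: algebra_simps)
qed

section \<open>Adjoints on finitely supported vectors and the self-commutator of the pencil\<close>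

text \<open>Scalar multiples of basis vectors form a family closed under the shift and its adjoint,
  so powers and commutators can be evaluated within it.\<close>

definition delta :: "nat \<Rightarrow> complex \<Rightarrow> nat \<Rightarrow> complex" where
  "delta n c = (\<lambda>k. if k = n then c else 0)"

lemma finite_support_delta: "finite {k. delta n c k \<noteq> 0}"
  by (rule finite_subset[of _ "{n}"]) (auto simp: delta_def)

lemma ell2_inner_delta: "ell2_inner x (delta n c) = x n * cnj c"
proof -
  have "ell2_inner x (delta n c) = (\<Sum>k\<in>{n}. x k * cnj (delta n c k))"
    unfolding ell2_inner_def by (rule suminf_finite) (auto simp: delta_def)
  then show ?thesis by (simp add: delta_def)
qed

lemma ell2_basis_eq_delta: "ell2_basis n = delta n 1"
  by (simp add: ell2_basis_def delta_def)

lemma ell2_inner_basis: "ell2_inner x (ell2_basis i) = x i"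
  by (simp add: ell2_basis_eq_delta ell2_inner_delta)

lemma ell2_inner_basis_left: "ell2_inner (ell2_basis i) x = cnj (x i)"
proof -
  have "ell2_inner (ell2_basis i) x = (\<Sum>n\<in>{i}. ell2_basis i n * cnj (x n))"
    unfolding ell2_inner_def by (rule suminf_finite) (auto simp: ell2_basis_def)
  then show ?thesis by (simp add: ell2_basis_def)
qed

lemma ell2_finite_support: "finite {n. x n \<noteq> 0} \<Longrightarrow> x \<in> ell2"
  unfolding ell2_def by (auto intro!: summable_finite)

text \<open>Testing against basis vectors determines every coordinate, which settles the uniqueness
  required by \<open>THE\<close>.\<close>

lemma ell2_adjoint_eqI:
  assumes "z \<in> ell2" "\<And>x. x \<in> ell2 \<Longrightarrow> ell2_inner (T x) y = ell2_inner x z"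
  shows "ell2_adjoint T y = z"
  unfolding ell2_adjoint_def
proof (rule the_equality)
  fix z' assume z': "z' \<in> ell2 \<and> (\<forall>x\<in>ell2. ell2_inner (T x) y = ell2_inner x z')"
  show "z' = z"
  proof
    fix n
    have "ell2_basis n \<in> ell2"
      by (rule ell2_finite_support) (simp add: ell2_basis_def)
    then have "ell2_inner (ell2_basis n) z' = ell2_inner (ell2_basis n) z"
      using assms z' by metis
    then show "z' n = z n" by (simp add: ell2_inner_basis_left)
  qed
qed (use assms in auto)

lemma ell2_adjoint_shift_pencil:
  assumes y: "finite {n. y n \<noteq> 0}"
  shows "ell2_adjoint (shift_pencil \<alpha> s) y =
    (\<lambda>n. \<alpha> n * y (Suc n) + cnj s * (\<alpha> n * \<alpha> (Suc n)) * y (Suc (Suc n)))" (is "_ = ?z")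
proof -
  obtain M where "{n. y n \<noteq> 0} \<subseteq> {..<M}"
    using finite_nat_iff_bounded y by blast
  then have M: "y n = 0" if "n \<ge> M" for n
    using that by (auto simp: subset_iff)
  show ?thesis
  proof (rule ell2_adjoint_eqI)
    have "{n. ?z n \<noteq> 0} \<subseteq> {..<M}"
      using M by (auto simp: not_less[symmetric])
        (metis add_0 le_SucI mult_zero_right not_le)
    then show "?z \<in> ell2"
      by (intro ell2_finite_support) (rule finite_subset, auto)
  next
    fix x
    \<comment> \<open>With the bound \<open>Suc (Suc M)\<close>, two index shifts leave
      \<open>M\<close> terms; after only one shift, the extra term contains
      \<open>y (Suc M) = 0\<close>.\<close>
    have "ell2_inner (shift_pencil \<alpha> s x) y = (\<Sum>n<Suc (Suc M). shift_pencil \<alpha> s x n * cnj (y n))"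
      unfolding ell2_inner_def by (rule suminf_finite) (auto simp: M)
    also have "\<dots> = (\<Sum>n<Suc (Suc M). weighted_shift \<alpha> x n * cnj (y n))
        + (\<Sum>n<Suc (Suc M). s * weighted_shift \<alpha> (weighted_shift \<alpha> x) n * cnj (y n))"
      by (simp only: shift_pencil_def distrib_right sum.distrib)
    also have "(\<Sum>n<Suc (Suc M). weighted_shift \<alpha> x n * cnj (y n))
        = (\<Sum>n<M. \<alpha> n * x n * cnj (y (Suc n)))"
      by (subst sum.lessThan_Suc_shift) (simp add: weighted_shift_def M)
    also have "(\<Sum>n<Suc (Suc M). s * weighted_shift \<alpha> (weighted_shift \<alpha> x) n * cnj (y n))
        = (\<Sum>n<M. s * (\<alpha> (Suc n) * (\<alpha> n * x n)) * cnj (y (Suc (Suc n))))"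
      by (subst sum.lessThan_Suc_shift, subst sum.lessThan_Suc_shift) (simp add: weighted_shift_def)
    also have "(\<Sum>n<M. \<alpha> n * x n * cnj (y (Suc n)))
        + (\<Sum>n<M. s * (\<alpha> (Suc n) * (\<alpha> n * x n)) * cnj (y (Suc (Suc n))))
        = (\<Sum>n<M. x n * cnj (?z n))"
      unfolding sum.distrib[symmetric] by (rule sum.cong) (auto simp: algebra_simps)
    also have "\<dots> = ell2_inner x ?z"
      unfolding ell2_inner_def by (rule suminf_finite[symmetric]) (auto simp: M not_less)
    finally show "ell2_inner (shift_pencil \<alpha> s x) y = ell2_inner x ?z" .
  qed
qed

text \<open>\<open>prev \<alpha> k n\<close> is \<open>\<alpha>\<^sub>n\<^sub>-\<^sub>k\<close> with the convention \<open>\<alpha>\<^sub>-\<^sub>1 = \<alpha>\<^sub>-\<^sub>2 = 0\<close>, and \<open>w\<^sub>n\<close> is \<open>(zcoef \<alpha> n)\<^sup>2\<close>.\<close>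

definition prev :: "(nat \<Rightarrow> real) \<Rightarrow> nat \<Rightarrow> nat \<Rightarrow> real" where
  "prev \<alpha> k n = (if n < k then 0 else \<alpha> (n - k))"

definition ucoef :: "(nat \<Rightarrow> real) \<Rightarrow> nat \<Rightarrow> real" where
  "ucoef \<alpha> n = (\<alpha> n)\<^sup>2 - (prev \<alpha> 1 n)\<^sup>2"

definition vcoef :: "(nat \<Rightarrow> real) \<Rightarrow> nat \<Rightarrow> real" where
  "vcoef \<alpha> n = (\<alpha> n)\<^sup>2 * (\<alpha> (Suc n))\<^sup>2 - (prev \<alpha> 1 n)\<^sup>2 * (prev \<alpha> 2 n)\<^sup>2"

definition zcoef :: "(nat \<Rightarrow> real) \<Rightarrow> nat \<Rightarrow> real" where
  "zcoef \<alpha> n = \<alpha> n * ((\<alpha> (Suc n))\<^sup>2 - (prev \<alpha> 1 n)\<^sup>2)"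

lemma shift_pencil_basis:
  "shift_pencil \<alpha> s (ell2_basis j) =
    (\<lambda>n. if n = Suc j then \<alpha> j else if n = Suc (Suc j) then s * (\<alpha> j * \<alpha> (Suc j)) else 0)"
  by (auto simp: shift_pencil_def weighted_shift_def ell2_basis_def fun_eq_iff split: nat.split)

text \<open>Each product combines a forward and a backward shift by 1 or 2, so the net displacement
  is at most 1 and the matrix is tridiagonal.\<close>

lemma commutator_pencil_basis:
  fixes \<alpha> :: "nat \<Rightarrow> real" and s :: complex
  defines "T \<equiv> shift_pencil \<alpha> s"
  shows "commutator (ell2_adjoint T) T (ell2_basis j) i =
     (if i = j then complex_of_real (ucoef \<alpha> i + (cmod s)\<^sup>2 * vcoef \<alpha> i)
      else if i = Suc j then s * zcoef \<alpha> j
      else if j = Suc i then cnj s * zcoef \<alpha> i else 0)"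
proof -
  have fin: "finite {n. ell2_basis j n \<noteq> 0}"
    by (simp add: ell2_basis_eq_delta finite_support_delta)
  have "{n. T (ell2_basis j) n \<noteq> 0} \<subseteq> {Suc j, Suc (Suc j)}"
    by (auto simp: T_def shift_pencil_basis)
  then have "finite {n. T (ell2_basis j) n \<noteq> 0}"
    by (rule finite_subset) auto
  note adj = ell2_adjoint_shift_pencil[OF this[unfolded T_def], unfolded shift_pencil_basis]
    shift_pencil_basis ell2_adjoint_shift_pencil[OF fin]
  have s: "s * cnj s = complex_of_real (cmod s * cmod s)"
    using complex_norm_square[of s] by (simp add: power2_eq_square)
  have s': "s * (cnj s * x) = complex_of_real (cmod s * cmod s) * x" for x
    using s by (simp add: mult.assoc[symmetric])
  consider "i = j" | "i = Suc j" | "j = Suc i" | "i \<noteq> j" "i \<noteq> Suc j" "j \<noteq> Suc i" by blast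
  then show ?thesis
  proof cases
    case 1
    show ?thesis unfolding commutator_def T_def shift_pencil_basis adj 1
      by (simp add: shift_pencil_def weighted_shift_def ell2_basis_def ucoef_def vcoef_def prev_def split: nat.split)
        (auto simp: numeral_2_eq_2 Suc_diff_Suc algebra_simps power2_eq_square s s')
  next
    case 2
    show ?thesis unfolding commutator_def T_def shift_pencil_basis adj 2
      by (simp add: shift_pencil_def weighted_shift_def ell2_basis_def zcoef_def prev_def split: nat.split)
        (auto simp: numeral_2_eq_2 algebra_simps power2_eq_square s s')
  next
    case 3
    show ?thesis unfolding commutator_def T_def shift_pencil_basis adj unfolding 3
      by (simp add: shift_pencil_def weighted_shift_def ell2_basis_def zcoef_def prev_def split: nat.split)
        (auto simp: numeral_2_eq_2 algebra_simps power2_eq_square s s')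
  next
    case 4
    then show ?thesis unfolding commutator_def T_def shift_pencil_basis adj 
      by (auto simp add: shift_pencil_def weighted_shift_def ell2_basis_def split: nat.split)
  qed
qed

section \<open>Scalar inequality extracted from 2-hyponormality\<close>

lemma weighted_shift_delta: "weighted_shift \<alpha> (delta n c) = delta (Suc n) (complex_of_real (\<alpha> n) * c)"
  by (auto simp: weighted_shift_def delta_def fun_eq_iff split: nat.split)

lemma weighted_shift_eq_pencil: "weighted_shift \<alpha> = shift_pencil \<alpha> 0"
  by (auto simp: shift_pencil_def fun_eq_iff)

text \<open>At \<open>n = 0\<close> the truncated index \<open>n - 1\<close> is harmless, because
  the coefficient \<open>prev \<alpha> 1 0\<close> is 0.\<close>

lemma ell2_adjoint_weighted_shift_delta:
  "ell2_adjoint (weighted_shift \<alpha>) (delta n c) = delta (n - 1) (complex_of_real (prev \<alpha> 1 n) * c)"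
  unfolding weighted_shift_eq_pencil ell2_adjoint_shift_pencil[OF finite_support_delta]
  by (auto simp: delta_def prev_def fun_eq_iff)

lemma two_hyponormal_coefs:
  assumes "k_hyponormal 2 (weighted_shift \<alpha>)" and u: "0 < ucoef \<alpha> n"
  shows "(zcoef \<alpha> n)\<^sup>2 \<le> ucoef \<alpha> n * vcoef \<alpha> (Suc n)"
proof -
  \<comment> \<open>On the span of \<open>(e\<^sub>n, 0)\<close> and \<open>(0, e\<^sub>n\<^sub>+\<^sub>1)\<close> the form is given by a \<open>2 \<times> 2\<close> matrix with diagonal
    \<open>u\<^sub>n, v\<^sub>n\<^sub>+\<^sub>1\<close> and off-diagonal entry \<open>zcoef \<alpha> n\<close>; this vector exposes its determinant.\<close>
  define \<xi> where "\<xi> = zcoef \<alpha> n"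
  define \<eta> where "\<eta> = - ucoef \<alpha> n"
  define x where "x = (\<lambda>i::nat. if i = 1 then delta n (complex_of_real \<xi>) else delta (Suc n) (complex_of_real \<eta>))"
  have "x i \<in> ell2" for i
    by (auto simp: x_def intro!: ell2_finite_support finite_support_delta)
  then have "(\<Sum>i=1..2. \<Sum>j=1..2. ell2_inner (commutator (ell2_adjoint (weighted_shift \<alpha>) ^^ j)
      (weighted_shift \<alpha> ^^ i) (x j)) (x i)) \<in> \<real>\<^sub>\<ge>\<^sub>0" (is "?S \<in> _")
    using assms by (simp add: k_hyponormal_def)
  also have "?S = complex_of_real
      (ucoef \<alpha> n * \<xi>\<^sup>2 + 2 * zcoef \<alpha> n * \<xi> * \<eta> + vcoef \<alpha> (Suc n) * \<eta>\<^sup>2)"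
  proof -
    have 12: "{1..2} = {1, 2::nat}" by auto
    show ?thesis
      by (simp add: 12 x_def)
        (simp add: numeral_2_eq_2 ell2_inner_delta commutator_def weighted_shift_delta
          ell2_adjoint_weighted_shift_delta,
         cases n, simp_all add: delta_def ucoef_def vcoef_def zcoef_def prev_def algebra_simps
          power2_eq_square)
  qed
  finally have "0 \<le> ucoef \<alpha> n * \<xi>\<^sup>2 + 2 * zcoef \<alpha> n * \<xi> * \<eta> + vcoef \<alpha> (Suc n) * \<eta>\<^sup>2"
    by (simp only: nonneg_Reals_of_real_iff)
  also have "\<dots> = ucoef \<alpha> n * (ucoef \<alpha> n * vcoef \<alpha> (Suc n) - (zcoef \<alpha> n)\<^sup>2)"
    by (simp add: \<xi>_def \<eta>_def algebra_simps power2_eq_square)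
  finally show ?thesis
    using u by (simp add: zero_le_mult_iff)
qed

section \<open>Continuants, their coefficients and the determinants of the compressions\<close>

text \<open>\<open>continuant u v w n\<close> is the determinant of the \<open>n \<times> n\<close> block, that is, of \<open>D\<^sub>n\<^sub>-\<^sub>1(s)\<close>.\<close>

fun continuant :: "(nat \<Rightarrow> real) \<Rightarrow> (nat \<Rightarrow> real) \<Rightarrow> (nat \<Rightarrow> real) \<Rightarrow> nat \<Rightarrow> real poly" where
  "continuant u v w 0 = 1"
| "continuant u v w (Suc 0) = [:u 0, v 0:]"
| "continuant u v w (Suc (Suc n)) =
     [:u (Suc n), v (Suc n):] * continuant u v w (Suc n) - [:0, w n:] * continuant u v w n"

definition excess :: "(nat \<Rightarrow> real) \<Rightarrow> (nat \<Rightarrow> real) \<Rightarrow> (nat \<Rightarrow> real) \<Rightarrow> nat \<Rightarrow> real poly" where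
  "excess u v w n = continuant u v w (Suc n) - smult (u n) (continuant u v w n)"

lemma excess_0: "excess u v w 0 = [:0, v 0:]"
  by (simp add: excess_def)

lemma excess_Suc:
  "excess u v w (Suc n) = pCons 0 (smult (v (Suc n)) (excess u v w n)
     + smult (u n * v (Suc n) - w n) (continuant u v w n))"
  by (simp add: excess_def algebra_simps smult_diff_left smult_diff_right)

lemma continuant_Suc: "continuant u v w (Suc n) = smult (u n) (continuant u v w n) + excess u v w n"
  by (simp add: excess_def)

lemma coeff_continuant_excess_eq_0:
  "(\<forall>i>n. coeff (continuant u v w n) i = 0) \<and> (\<forall>i>Suc n. coeff (excess u v w n) i = 0)"
proof (induction n)
  case 0
  then show ?case by (auto simp: excess_0 coeff_pCons split: nat.split)
next
  case (Suc n)
  then show ?case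
    by (auto simp: excess_Suc continuant_Suc coeff_pCons simp del: continuant.simps split: nat.split)
qed

lemmas coeff_continuant_eq_0 = coeff_continuant_excess_eq_0[THEN conjunct1, rule_format]
lemmas coeff_excess_eq_0 = coeff_continuant_excess_eq_0[THEN conjunct2, rule_format]

text \<open>Multiplication by \<open>u n\<close> keeps degrees up to \<open>n\<close> positive; the
  top coefficient of \<open>excess\<close>, a product of values of \<open>v\<close>, supplies degree
  \<open>Suc n\<close>.\<close>

lemma continuant_coeff_pos:
  assumes u: "\<And>n. 0 < u n" and v: "\<And>n. 0 < v n" and p: "\<And>n. w n \<le> u n * v (Suc n)"
  shows "0 \<le> coeff (excess u v w n) i \<and> 0 \<le> coeff (continuant u v w n) i \<and>
    0 < coeff (excess u v w n) (Suc n) \<and> (i \<le> n \<longrightarrow> 0 < coeff (continuant u v w n) i)"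
proof (induction n arbitrary: i)
  case 0
  then show ?case using v[of 0] by (auto simp: excess_0 coeff_pCons split: nat.split)
next
  case (Suc n)
  have e: "0 \<le> coeff (excess u v w n) j" "0 \<le> coeff (continuant u v w n) j"
    "0 < coeff (excess u v w n) (Suc n)" "j \<le> n \<Longrightarrow> 0 < coeff (continuant u v w n) j" for j
    using Suc by auto
  note uv = u[of n] v[of "Suc n"] p[of n]
  have c: "0 < coeff (continuant u v w (Suc n)) j" if "j \<le> Suc n" for j
    using that e uv
    by (cases "j = Suc n") (simp_all add: continuant_Suc add_nonneg_pos add_pos_nonneg del: continuant.simps)
  have "0 \<le> coeff (continuant u v w (Suc n)) i"
    using e uv by (simp add: continuant_Suc del: continuant.simps)
  moreover have "0 \<le> coeff (excess u v w (Suc n)) i"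
    using e uv by (auto simp add: excess_Suc coeff_pCons split: nat.split)
  moreover have "0 < coeff (excess u v w (Suc n)) (Suc (Suc n))"
    using e uv by (auto simp add: excess_Suc intro!: add_pos_nonneg)
  ultimately show ?case using c by blast
qed

text \<open>Off-diagonal entries enter only through products of symmetric pairs, where
  \<open>s\<close> and \<open>cnj s\<close> combine to the squared modulus.\<close>

lemma det_eq_poly_continuant:
  fixes s :: complex
  shows "det (mat n n (\<lambda>(i, j). if i = j then complex_of_real (u i + (cmod s)\<^sup>2 * v i)
      else if i = Suc j then s * complex_of_real (z j)
      else if j = Suc i then cnj s * complex_of_real (z i) else 0))
    = complex_of_real (poly (continuant u v (\<lambda>n. (z n)\<^sup>2) n) ((cmod s)\<^sup>2))"
proof (induction n rule: induct_nat_012)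
  case (ge2 m)
  have s: "s * complex_of_real (z m) * (cnj s * complex_of_real (z m)) = complex_of_real ((cmod s)\<^sup>2 * (z m)\<^sup>2)"
    unfolding of_real_mult complex_norm_square by (simp add: power2_eq_square)
  show ?case
    by (subst det_tridiagonal, force)
      (simp add: ge2 s del: of_real_mult of_real_add of_real_power, simp add: algebra_simps)
qed (simp_all add: det_single)

lemma Dmat_eq:
  "Dmat \<alpha> n s = mat (Suc n) (Suc n) (\<lambda>(i, j).
      if i = j then complex_of_real (ucoef \<alpha> i + (cmod s)\<^sup>2 * vcoef \<alpha> i)
      else if i = Suc j then s * zcoef \<alpha> j
      else if j = Suc i then cnj s * zcoef \<alpha> i else 0)"
proof -
  have proj: "basis_proj n (ell2_basis j) = ell2_basis j" if "j \<le> n" for j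
    using that by (auto simp: basis_proj_def ell2_basis_def)
  have app: "basis_proj n x i = x i" if "i \<le> n" for x i
    using that by (simp add: basis_proj_def)
  show ?thesis
    unfolding Dmat_def Let_def
    by (rule eq_matI) (auto simp: proj ell2_inner_basis commutator_pencil_basis[simplified] app)
qed

abbreviation shift_continuant :: "(nat \<Rightarrow> real) \<Rightarrow> nat \<Rightarrow> real poly" where
  "shift_continuant \<alpha> \<equiv> continuant (ucoef \<alpha>) (vcoef \<alpha>) (\<lambda>n. (zcoef \<alpha> n)\<^sup>2)"

abbreviation shift_excess :: "(nat \<Rightarrow> real) \<Rightarrow> nat \<Rightarrow> real poly" where
  "shift_excess \<alpha> \<equiv> excess (ucoef \<alpha>) (vcoef \<alpha>) (\<lambda>n. (zcoef \<alpha> n)\<^sup>2)"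

lemma positively_quadratically_hyponormalI:
  assumes "\<And>n i. 0 \<le> coeff (shift_continuant \<alpha> n) i"
  shows "positively_quadratically_hyponormal \<alpha>"
  unfolding positively_quadratically_hyponormal_def
proof (intro allI exI conjI impI)
  fix n s
  have "poly (shift_continuant \<alpha> (Suc n)) x = (\<Sum>i\<le>Suc n. coeff (shift_continuant \<alpha> (Suc n)) i * x ^ i)" for x
    unfolding poly_altdef
    by (rule sum.mono_neutral_left)
      (auto simp: coeff_eq_0 coeff_continuant_eq_0 simp del: continuant.simps intro!: degree_le)
  then show "det (Dmat \<alpha> n s) =
      complex_of_real (\<Sum>i\<le>n + 1. coeff (shift_continuant \<alpha> (Suc n)) i * ((cmod s)\<^sup>2) ^ i)"
    by (simp add: Dmat_eq det_eq_poly_continuant del: continuant.simps)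
qed (rule assms)

section \<open>Ratios of consecutive increments of a bounded sequence\<close>

lemma increment_ratio_bounded:
  fixes a :: "nat \<Rightarrow> real"
  defines "d \<equiv> \<lambda>n. a (Suc n) - a n"
  assumes pos: "\<And>n. 0 < a n" and bound: "\<And>n. a n \<le> A" and d: "\<And>n. 0 < d n"
    and conv: "\<And>n. a n * (d (Suc n))\<^sup>2 \<le> a (Suc (Suc n)) * d n * d (Suc (Suc n))"
  shows "\<exists>R\<ge>0. \<forall>n. d (Suc n) \<le> R * d n \<and> d n \<le> R * d (Suc n)"
proof -
  define y where "y = (\<lambda>n. a n * a (Suc n) * d (Suc n) / d n)"
  have dn: "d n \<noteq> 0" for n using d[of n] by simp
  have "y n \<le> y (Suc n)" for n
  proof -
    have "a (Suc n) * (a n * (d (Suc n))\<^sup>2) \<le> a (Suc n) * (a (Suc (Suc n)) * d n * d (Suc (Suc n)))"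
      using conv pos[of "Suc n"] by (intro mult_left_mono) auto
    then show ?thesis
      using d[of n] d[of "Suc n"] by (simp add: y_def field_simps power2_eq_square)
  qed
  then have y: "y m \<le> y n" if "m \<le> n" for m n
    using lift_Suc_mono_le[of y] that by blast
  have a_mono: "a m \<le> a n" if "m \<le> n" for m n
    using lift_Suc_mono_le[of a m n] that d by (simp add: d_def less_imp_le)
  have A: "0 < A" using pos[of 0] bound[of 0] by simp
  have aa: "a n * a (Suc n) \<le> A\<^sup>2" for n
    unfolding power2_eq_square using bound pos by (intro mult_mono) (auto intro: less_imp_le A)
  have y_le: "y n \<le> A\<^sup>2" for n
  proof (rule ccontr)
    assume "\<not> ?thesis"
    then have yn: "A\<^sup>2 < y m" if "n \<le> m" for m using y[OF that] by simp
    have grow: "d m \<le> d (Suc m)" if "n \<le> m" for m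
    proof -
      have "A\<^sup>2 * d m \<le> a m * a (Suc m) * d (Suc m)"
        using yn[OF that] d[of m] by (simp add: y_def field_simps)
      also have "\<dots> \<le> A\<^sup>2 * d (Suc m)"
        using aa d[of "Suc m"] by (intro mult_right_mono) auto
      finally show ?thesis using A by simp
    qed
    have dk: "d n \<le> d (n + k)" for k
      by (induction k) (use grow in \<open>auto intro: order_trans\<close>)
    have ak: "k * d n \<le> a (n + k)" for k
    proof (induction k)
      case (Suc k)
      then show ?case using dk[of k] by (simp add: d_def algebra_simps)
    qed (use pos in \<open>simp add: less_imp_le\<close>)
    obtain k :: nat where "A < k * d n" using reals_Archimedean3[OF d] by blast
    with ak[of k] bound[of "n + k"] show False by simp
  qed
  have y0: "0 < y 0" using pos d by (simp add: y_def)
  \<comment> \<open>The ratio \<open>d (Suc n) / d n\<close> equals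
    \<open>y n / (a n * a (Suc n))\<close>, with \<open>y n\<close> between \<open>y 0\<close> and
    \<open>A\<^sup>2\<close> and the denominator between \<open>a 0 * a 1\<close> and
    \<open>A\<^sup>2\<close>.\<close>
  define R where "R = max (A\<^sup>2 / (a 0 * a 1)) (A\<^sup>2 / y 0)"
  have a01: "0 < a 0 * a 1" using pos by simp
  have "d (Suc n) \<le> R * d n" for n
  proof -
    have "a 0 * a 1 * d (Suc n) \<le> a n * a (Suc n) * d (Suc n)"
      using pos d a_mono by (intro mult_right_mono mult_mono) (auto intro: less_imp_le)
    also have "\<dots> = y n * d n" using dn by (simp add: y_def)
    also have "\<dots> \<le> A\<^sup>2 * d n" using y_le d[of n] by (intro mult_right_mono) auto
    finally have "d (Suc n) \<le> A\<^sup>2 / (a 0 * a 1) * d n"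
      using a01 by (simp add: field_simps)
    also have "\<dots> \<le> R * d n" using d[of n] by (intro mult_right_mono) (auto simp: R_def)
    finally show ?thesis .
  qed
  moreover have "d n \<le> R * d (Suc n)" for n
  proof -
    have "y 0 * d n \<le> y n * d n" using y d[of n] by (intro mult_right_mono) auto
    also have "\<dots> = a n * a (Suc n) * d (Suc n)" using dn by (simp add: y_def)
    also have "\<dots> \<le> A\<^sup>2 * d (Suc n)" using aa d[of "Suc n"] by (intro mult_right_mono) auto
    finally have "d n \<le> A\<^sup>2 / y 0 * d (Suc n)"
      using y0 by (simp add: field_simps)
    also have "\<dots> \<le> R * d (Suc n)" using d[of "Suc n"] by (intro mult_right_mono) (auto simp: R_def)
    finally show ?thesis .
  qed
  moreover have "0 \<le> R" using y0 by (simp add: R_def le_max_iff_disj)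
  ultimately show ?thesis by blast
qed

section \<open>Persistence of nonnegative coefficients under perturbed initial data\<close>

lemma perturbed_continuant_coeff_nonneg:
  fixes u v w :: "nat \<Rightarrow> real" and m \<epsilon> R :: real
  assumes p: "\<And>n. n \<ge> M \<Longrightarrow> w n \<le> u n * v (Suc n)"
    and u: "\<And>n. n > M \<Longrightarrow> 0 < u n" and v: "\<And>n. n > M \<Longrightarrow> 0 < v n"
    and vR: "\<And>n. n > M \<Longrightarrow> v n \<le> R * u n"
    and R: "1 \<le> R" and \<epsilon>: "0 \<le> \<epsilon>" and m: "real (Suc M) * \<epsilon> * R ^ Suc M \<le> m"
    and base: "\<And>n i. n \<le> M \<Longrightarrow> 0 \<le> coeff (continuant u v w n) i"
    and c: "\<And>i. i \<le> Suc M \<Longrightarrow> m \<le> coeff (continuant u v w (Suc M)) i"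
    and e: "\<And>i. i \<le> M \<Longrightarrow> - \<epsilon> \<le> coeff (excess u v w M) i"
    and e_top: "m \<le> coeff (excess u v w M) (Suc M)"
  shows "0 \<le> coeff (continuant u v w n) i"
proof -
  \<comment> \<open>\<open>U k * S k i\<close> is the coefficient \<open>i\<close> of \<open>d\<^sub>M\<^sub>+\<^sub>1\<^sub>+\<^sub>k\<close> when all \<open>u\<^sub>n v\<^sub>n\<^sub>+\<^sub>1 - w\<^sub>n\<close> vanish. In \<open>S k i\<close> the
    top coefficient of \<open>e\<^sub>M\<close> has weight \<open>\<rho> (i - Suc M)\<close>; at most \<open>Suc M\<close> other terms are nonzero.\<close>
  define V where "V = (\<lambda>k. \<Prod>l<k. v (Suc M + l))"
  define U where "U = (\<lambda>k. \<Prod>l<k. u (Suc M + l))"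
  define \<rho> where "\<rho> = (\<lambda>k. V k / U k)"
  define B where "B = (\<lambda>i l. if l \<le> i then coeff (excess u v w M) (i - l) else 0)"
  define S where "S = (\<lambda>k i. coeff (continuant u v w (Suc M)) i + (\<Sum>l\<in>{1..k}. \<rho> l * B i l))"
  have U: "0 < U k" for k unfolding U_def by (intro prod_pos) (use u in auto)
  have V: "0 < V k" for k unfolding V_def by (intro prod_pos) (use v in auto)
  have \<rho>: "0 < \<rho> k" for k using U V by (simp add: \<rho>_def)
  have U\<rho>: "U k * \<rho> k = V k" for k using U[of k] by (simp add: \<rho>_def)
  have U_Suc: "U (Suc k) = u (Suc M + k) * U k" and V_Suc: "V (Suc k) = v (Suc M + k) * V k" for k
    by (simp_all add: U_def V_def)
  have \<rho>_Suc: "\<rho> (Suc k) \<le> R * \<rho> k" for k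
  proof -
    have "\<rho> (Suc k) = v (Suc M + k) / u (Suc M + k) * \<rho> k"
      by (simp add: \<rho>_def U_Suc V_Suc)
    also have "\<dots> \<le> R * \<rho> k"
      using u[of "Suc M + k"] vR[of "Suc M + k"] \<rho>[of k]
      by (intro mult_right_mono) (auto simp: field_simps)
    finally show ?thesis .
  qed
  have \<rho>_add: "\<rho> (k + l) \<le> R ^ l * \<rho> k" for k l
  proof (induction l)
    case (Suc l)
    have "\<rho> (k + Suc l) \<le> R * \<rho> (k + l)" using \<rho>_Suc by simp
    also have "\<dots> \<le> R * (R ^ l * \<rho> k)" using Suc R by (intro mult_left_mono) auto
    finally show ?case by (simp add: algebra_simps)
  qed simp
  have m0: "0 \<le> m" using m R \<epsilon> by (smt (verit) mult_nonneg_nonneg of_nat_0_le_iff zero_le_power)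
  have S: "0 \<le> S k i" if i: "i \<le> Suc M + k" for k i
  proof -
    \<comment> \<open>At \<open>l = l0\<close> the top coefficient of the excess appears if
      \<open>i > Suc M\<close>; then \<open>i \<le> Suc M + k\<close> puts \<open>l0\<close> into
      the summation range. Otherwise \<open>l0 = 0\<close>, and the continuant coefficient, at least
      \<open>m = \<rho> 0 * m\<close>, compensates instead.\<close>
    define l0 where "l0 = i - Suc M"
    have term_ge: "\<rho> l * B i l \<ge> (if l = l0 then \<rho> l0 * m else 0)
        - (if l \<in> {l0<..i} then \<epsilon> * R ^ Suc M * \<rho> l0 else 0)" if l: "l \<in> {1..k}" for l
    proof -
      consider "l < l0" | "l = l0" | "l0 < l" "l \<le> i" | "l0 < l" "i < l" by linarith
      then show ?thesis
      proof cases
        case 1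
        then have "Suc M < i - l" by (simp add: l0_def)
        then show ?thesis using 1 by (simp add: B_def coeff_excess_eq_0)
      next
        case 2
        then have "l \<le> i" "i - l = Suc M" using l by (auto simp: l0_def)
        then show ?thesis using 2 e_top \<rho>[of l0] by (simp add: B_def)
      next
        case 3
        then have "- \<epsilon> \<le> B i l" using e by (simp add: B_def l0_def)
        then have "\<rho> l * (- \<epsilon>) \<le> \<rho> l * B i l" using \<rho>[of l] by (intro mult_left_mono) auto
        moreover have "\<rho> l \<le> R ^ Suc M * \<rho> l0"
        proof -
          have "\<rho> l \<le> R ^ (l - l0) * \<rho> l0" using \<rho>_add[of l0 "l - l0"] 3 by simp
          also have "\<dots> \<le> R ^ Suc M * \<rho> l0"
            using 3 R \<rho>[of l0] by (intro mult_right_mono power_increasing) (auto simp: l0_def)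
          finally show ?thesis .
        qed
        then have "\<rho> l * \<epsilon> \<le> R ^ Suc M * \<rho> l0 * \<epsilon>" using \<epsilon> by (rule mult_right_mono)
        ultimately show ?thesis using 3 by (simp add: algebra_simps)
      next
        case 4
        then show ?thesis by (simp add: B_def)
      qed
    qed
    have "(\<Sum>l\<in>{1..k}. (if l = l0 then \<rho> l0 * m else 0)
        - (if l \<in> {l0<..i} then \<epsilon> * R ^ Suc M * \<rho> l0 else 0)) \<le> (\<Sum>l\<in>{1..k}. \<rho> l * B i l)"
      using term_ge by (rule sum_mono)
    moreover have "(\<Sum>l\<in>{1..k}. (if l = l0 then \<rho> l0 * m else 0)
        - (if l \<in> {l0<..i} then \<epsilon> * R ^ Suc M * \<rho> l0 else 0))
      = (if l0 \<in> {1..k} then \<rho> l0 * m else 0) - card ({1..k} \<inter> {l0<..i}) * (\<epsilon> * R ^ Suc M * \<rho> l0)"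
      by (simp add: sum_subtractf sum.If_cases del: greaterThanAtMost_iff power_Suc)
    \<comment> \<open>At most \<open>Suc M\<close> terms are negative, each losing at most
      \<open>\<epsilon> * R ^ Suc M * \<rho> l0\<close>; the assumed relation between
      \<open>m\<close> and \<open>\<epsilon>\<close> lets the single gain
      \<open>\<rho> l0 * m\<close> cover them.\<close>
    moreover have "card ({1..k} \<inter> {l0<..i}) * (\<epsilon> * R ^ Suc M * \<rho> l0) \<le> \<rho> l0 * m"
    proof -
      have "card ({1..k} \<inter> {l0<..i}) \<le> card {l0<..i}" by (intro card_mono) auto
      also have "\<dots> \<le> Suc M" by (simp add: l0_def)
      finally have "card ({1..k} \<inter> {l0<..i}) * (\<epsilon> * R ^ Suc M * \<rho> l0) \<le> Suc M * (\<epsilon> * R ^ Suc M * \<rho> l0)"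
        using \<epsilon> R \<rho>[of l0] by (intro mult_right_mono) auto
      also have "\<dots> = \<rho> l0 * (real (Suc M) * \<epsilon> * R ^ Suc M)" by simp
      also have "\<dots> \<le> \<rho> l0 * m" using m \<rho>[of l0] by (intro mult_left_mono) auto
      finally show ?thesis .
    qed
    moreover have "\<rho> l0 * m \<le> coeff (continuant u v w (Suc M)) i + (if l0 \<in> {1..k} then \<rho> l0 * m else 0)"
    proof (cases "l0 = 0")
      case True
      then show ?thesis using c[of i] by (simp add: \<rho>_def U_def V_def l0_def)
    next
      case False
      have "0 \<le> coeff (continuant u v w (Suc M)) i"
        using c[of i] m0 by (cases "i \<le> Suc M") (auto simp: coeff_continuant_eq_0 simp del: continuant.simps)
      moreover have "l0 \<in> {1..k}" using False i by (auto simp: l0_def)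
      ultimately show ?thesis by simp
    qed
    ultimately show ?thesis by (simp add: S_def)
  qed
  \<comment> \<open>The three bounds advance together: nonnegative continuants permit dropping the
    \<open>u v - w\<close> term from the excess, whose bound feeds the next continuant.\<close>
  have main: "(\<forall>i. 0 \<le> coeff (continuant u v w (M + k)) i) \<and>
      (\<forall>i. U k * S k i \<le> coeff (continuant u v w (Suc M + k)) i) \<and>
      (\<forall>i. V k * B i k \<le> coeff (excess u v w (M + k)) i)" for k
  proof (induction k)
    case 0
    then show ?case using base[of M] by (simp add: U_def V_def S_def B_def)
  next
    case (Suc k)
    have nonneg: "0 \<le> coeff (continuant u v w (Suc M + k)) i" for i
    proof (cases "i \<le> Suc M + k")
      case True
      then have "0 \<le> U k * S k i" using S U[of k] by simp
      with Suc show ?thesis by (meson order_trans)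
    qed (simp add: coeff_continuant_eq_0 del: continuant.simps)
    have excess: "V (Suc k) * B i (Suc k) \<le> coeff (excess u v w (M + Suc k)) i" for i
    proof (cases i)
      case (Suc j)
      have "v (Suc M + k) * (V k * B j k) \<le> v (Suc M + k) * coeff (excess u v w (M + k)) j"
        using Suc.IH v[of "Suc M + k"] by (intro mult_left_mono) auto
      moreover have "0 \<le> (u (M + k) * v (Suc (M + k)) - w (M + k)) * coeff (continuant u v w (M + k)) j"
        using Suc.IH p[of "M + k"] by (intro mult_nonneg_nonneg) auto
      moreover have "V (Suc k) * B i (Suc k) = v (Suc M + k) * (V k * B j k)"
        using Suc by (simp add: V_Suc B_def)
      ultimately show ?thesis using Suc by (simp add: excess_Suc)
    qed (simp add: B_def excess_Suc)
    have "U (Suc k) * S (Suc k) i \<le> coeff (continuant u v w (Suc M + Suc k)) i" for i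
    proof -
      have "U (Suc k) * S (Suc k) i = u (Suc M + k) * (U k * S k i) + V (Suc k) * B i (Suc k)"
        unfolding U\<rho>[symmetric] by (simp add: S_def U_Suc distrib_left mult.assoc)
      also have "\<dots> \<le> u (Suc M + k) * coeff (continuant u v w (Suc M + k)) i
          + coeff (excess u v w (Suc M + k)) i"
        using Suc.IH u[of "Suc M + k"] excess[of i] by (intro add_mono mult_left_mono) auto
      also have "\<dots> = coeff (continuant u v w (Suc M + Suc k)) i"
        using continuant_Suc[of u v w "Suc M + k"]
        by (simp only: add_Suc_right coeff_add coeff_smult)
      finally show ?thesis .
    qed
    then show ?case using nonneg excess by simp
  qed
  show ?thesis
  proof (cases "n \<le> M")
    case False
    then obtain k where "n = M + k" by (metis le_add_diff_inverse nat_le_linear)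
    then show ?thesis using main by blast
  qed (use base in auto)
qed

section \<open>Uniform comparison of the diagonal coefficients\<close>

lemma vcoef_le_ucoef:
  assumes pos: "\<And>n. 0 < \<alpha> n" and "Bseq \<alpha>" and mono: "strict_mono \<alpha>"
    and hyp: "\<And>n. (zcoef \<alpha> n)\<^sup>2 \<le> ucoef \<alpha> n * vcoef \<alpha> (Suc n)"
  shows "\<exists>R\<ge>1. \<forall>n\<ge>2. vcoef \<alpha> n \<le> R * ucoef \<alpha> n"
proof -
  define a where "a = (\<lambda>n. (\<alpha> n)\<^sup>2)"
  define d where "d = (\<lambda>n. a (Suc n) - a n)"
  obtain K where K: "\<And>n. \<bar>\<alpha> n\<bar> \<le> K" using \<open>Bseq \<alpha>\<close> by (auto simp: Bseq_def)
  have aA: "a n \<le> K\<^sup>2" for n using power_mono[OF K[of n], of 2] by (simp add: a_def)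
  have a: "0 < a n" for n using pos[of n] by (simp add: a_def)
  have d: "0 < d n" for n
    using strict_monoD[OF mono, of n "Suc n"] pos[of n] by (simp add: d_def a_def power_strict_mono)
  have conv: "a n * (d (Suc n))\<^sup>2 \<le> a (Suc (Suc n)) * d n * d (Suc (Suc n))" for n
  proof -
    \<comment> \<open>Expressed in increments, the two sides share all terms except those of the
      claimed inequality.\<close>
    have "a (Suc n) * (a (Suc (Suc n)) - a n)\<^sup>2 \<le>
        (a (Suc n) - a n) * (a (Suc (Suc n)) * a (Suc (Suc (Suc n))) - a (Suc n) * a n)"
      using hyp[of "Suc n"]
      by (simp add: zcoef_def ucoef_def vcoef_def prev_def a_def power_mult_distrib)
    then show ?thesis by (simp add: d_def algebra_simps power2_eq_square)
  qed
  obtain R where R: "0 \<le> R" "\<And>n. d (Suc n) \<le> R * d n" "\<And>n. d n \<le> R * d (Suc n)"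
    using increment_ratio_bounded[of a "K\<^sup>2"] a aA d conv unfolding d_def by blast
  define Q where "Q = max 1 (K\<^sup>2 * (2 * R + 1) + K\<^sup>2)"
  have "vcoef \<alpha> n \<le> Q * ucoef \<alpha> n" if n: "2 \<le> n" for n
  proof -
    obtain k where k: "n = Suc (Suc k)" using n by (metis add_2_eq_Suc le_Suc_ex)
    \<comment> \<open>Only three neighbouring increments occur, and the outer two are at most
      \<open>R\<close> times the middle one, which is \<open>ucoef \<alpha> n\<close>.\<close>
    have "vcoef \<alpha> n = a (Suc (Suc k)) * (d (Suc (Suc k)) + d (Suc k) + d k) + a k * d (Suc k)"
      by (simp add: k vcoef_def prev_def a_def d_def algebra_simps)
    also have "\<dots> \<le> K\<^sup>2 * (R * d (Suc k) + d (Suc k) + R * d (Suc k)) + K\<^sup>2 * d (Suc k)"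
      using R d aA a by (intro add_mono mult_mono) (auto simp: less_imp_le add_nonneg_nonneg)
    also have "\<dots> = (K\<^sup>2 * (2 * R + 1) + K\<^sup>2) * d (Suc k)" by (simp add: algebra_simps)
    also have "\<dots> \<le> Q * d (Suc k)"
      using d[of "Suc k"] by (intro mult_right_mono) (auto simp: Q_def)
    also have "d (Suc k) = ucoef \<alpha> n" by (simp add: k d_def a_def ucoef_def prev_def)
    finally show ?thesis .
  qed
  moreover have "1 \<le> Q" by (simp add: Q_def)
  ultimately show ?thesis by blast
qed

section \<open>Finite rank perturbations as a filter, and continuity of the coefficients\<close>

text \<open>As a filter, the choice of a small \<delta> becomes \<open>eventually\<close>: finitely
  many conditions combine directly and limits supply each of them.\<close>

definition perturbations :: "nat \<Rightarrow> (nat \<Rightarrow> real) \<Rightarrow> (nat \<Rightarrow> real) filter" where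
  "perturbations N \<alpha> = (INF \<delta>\<in>{0<..}. principal
     {\<beta>. (\<forall>n>N. \<beta> n = \<alpha> n) \<and> (\<forall>n\<le>N. \<bar>\<beta> n - \<alpha> n\<bar> < \<delta>)})"

lemma eventually_perturbations:
  "eventually P (perturbations N \<alpha>) \<longleftrightarrow>
    (\<exists>\<delta>>0. \<forall>\<beta>. (\<forall>n>N. \<beta> n = \<alpha> n) \<and> (\<forall>n\<le>N. \<bar>\<beta> n - \<alpha> n\<bar> < \<delta>) \<longrightarrow> P \<beta>)"
  unfolding perturbations_def
proof (subst eventually_INF_base)
  fix x y :: real assume "x \<in> {0<..}" "y \<in> {0<..}"
  then show "\<exists>z\<in>{0<..}.
      principal {\<beta>. (\<forall>n>N. \<beta> n = \<alpha> n) \<and> (\<forall>n\<le>N. \<bar>\<beta> n - \<alpha> n\<bar> < z)} \<le>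
      inf (principal {\<beta>. (\<forall>n>N. \<beta> n = \<alpha> n) \<and> (\<forall>n\<le>N. \<bar>\<beta> n - \<alpha> n\<bar> < x)})
        (principal {\<beta>. (\<forall>n>N. \<beta> n = \<alpha> n) \<and> (\<forall>n\<le>N. \<bar>\<beta> n - \<alpha> n\<bar> < y)})"
    by (intro bexI[of _ "min x y"]) auto
qed (auto simp: eventually_principal)

lemma tendsto_weight [tendsto_intros]: "((\<lambda>\<beta>. \<beta> n) \<longlongrightarrow> \<alpha> n) (perturbations N \<alpha>)"
proof (rule tendstoI)
  fix e :: real assume "0 < e"
  then show "\<forall>\<^sub>F \<beta> in perturbations N \<alpha>. dist (\<beta> n) (\<alpha> n) < e"
    unfolding eventually_perturbations dist_real_def
    by (metis abs_zero diff_self not_le)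
qed

lemma tendsto_prev [tendsto_intros]: "((\<lambda>\<beta>. prev \<beta> k n) \<longlongrightarrow> prev \<alpha> k n) (perturbations N \<alpha>)"
  unfolding prev_def by (auto intro: tendsto_intros)

lemma tendsto_coefs [tendsto_intros]:
  "((\<lambda>\<beta>. ucoef \<beta> n) \<longlongrightarrow> ucoef \<alpha> n) (perturbations N \<alpha>)"
  "((\<lambda>\<beta>. vcoef \<beta> n) \<longlongrightarrow> vcoef \<alpha> n) (perturbations N \<alpha>)"
  "((\<lambda>\<beta>. zcoef \<beta> n) \<longlongrightarrow> zcoef \<alpha> n) (perturbations N \<alpha>)"
  unfolding ucoef_def vcoef_def zcoef_def by (intro tendsto_intros)+

lemma tendsto_coeff_continuant_excess:
  "(\<forall>i. ((\<lambda>\<beta>. coeff (shift_continuant \<beta> n) i) \<longlongrightarrow> coeff (shift_continuant \<alpha> n) i) (perturbations N \<alpha>)) \<and>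
   (\<forall>i. ((\<lambda>\<beta>. coeff (shift_excess \<beta> n) i) \<longlongrightarrow> coeff (shift_excess \<alpha> n) i) (perturbations N \<alpha>))"
proof (induction n)
  case 0
  then show ?case
    by (auto simp: excess_0 coeff_pCons intro!: tendsto_intros split: nat.split)
next
  case (Suc n)
  then show ?case
    by (auto simp: excess_Suc continuant_Suc coeff_pCons simp del: continuant.simps
        intro!: tendsto_intros split: nat.split)
qed

lemmas tendsto_coeff_continuant = tendsto_coeff_continuant_excess[THEN conjunct1, rule_format]
lemmas tendsto_coeff_excess = tendsto_coeff_continuant_excess[THEN conjunct2, rule_format]

theorem theorem2p3:
  fixes \<alpha> :: "nat \<Rightarrow> real"
  assumes "\<And>n. 0 < \<alpha> n"
    and "Bseq \<alpha>"
    and "strict_mono \<alpha>"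
    and "k_hyponormal 2 (weighted_shift \<alpha>)"
  shows "\<forall>N. \<exists>\<delta>>0. \<forall>\<alpha>' :: nat \<Rightarrow> real.
           (\<forall>n. 0 < \<alpha>' n) \<and> \<alpha>' \<noteq> \<alpha> \<and> (\<forall>n>N. \<alpha>' n = \<alpha> n) \<and>
           (\<forall>n\<le>N. \<bar>\<alpha>' n - \<alpha> n\<bar> < \<delta>)
           \<longrightarrow> positively_quadratically_hyponormal \<alpha>'"
proof
  fix N
  \<comment> \<open>Since \<open>vcoef\<close> reaches back two indices, it is unchanged for
    \<open>n > N + 2\<close>; \<open>ucoef\<close> and \<open>zcoef\<close> are unchanged already
    from \<open>M\<close> on.\<close>
  define M where "M = Suc (Suc N)"
  have less: "m < n \<Longrightarrow> \<alpha> m < \<alpha> n" for m n using assms(3) by (rule strict_monoD)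
  have u: "0 < ucoef \<alpha> n" for n
    using assms(1)[of n] assms(1)[of "n - 1"] less[of "n - 1" n]
    by (auto simp: ucoef_def prev_def power_strict_mono)
  have v: "0 < vcoef \<alpha> n" for n
  proof -
    have "prev \<alpha> 1 n * prev \<alpha> 2 n < \<alpha> n * \<alpha> (Suc n)" "0 \<le> prev \<alpha> 1 n * prev \<alpha> 2 n"
      using less[of "n - 1" n] less[of "n - 2" "Suc n"] assms(1)
      by (auto simp: prev_def less_imp_le intro!: mult_strict_mono)
    then have "(prev \<alpha> 1 n * prev \<alpha> 2 n)\<^sup>2 < (\<alpha> n * \<alpha> (Suc n))\<^sup>2"
      by (intro power_strict_mono) auto
    then show ?thesis by (simp add: vcoef_def power_mult_distrib)
  qed
  have p: "(zcoef \<alpha> n)\<^sup>2 \<le> ucoef \<alpha> n * vcoef \<alpha> (Suc n)" for n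
    using assms(4) u by (rule two_hyponormal_coefs)
  obtain R where R: "1 \<le> R" "\<And>n. 2 \<le> n \<Longrightarrow> vcoef \<alpha> n \<le> R * ucoef \<alpha> n"
    using vcoef_le_ucoef[OF assms(1-3) p] by blast
  note pos = continuant_coeff_pos[of "ucoef \<alpha>" "vcoef \<alpha>" "\<lambda>n. (zcoef \<alpha> n)\<^sup>2", OF u v p]
  define L where "L = insert (coeff (shift_excess \<alpha> M) (Suc M))
      (coeff (shift_continuant \<alpha> (Suc M)) ` {..Suc M})"
  \<comment> \<open>Halving the least coefficient leaves strict room for the limit argument.\<close>
  define m where "m = Min L / 2"
  have L: "finite L" "L \<noteq> {}" by (simp_all add: L_def)
  have "\<forall>x\<in>L. 0 < x" using pos by (auto simp: L_def simp del: continuant.simps)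
  then have m: "0 < m" using L by (simp add: m_def)
  have "m < x" if "x \<in> L" for x
    using Min_le[OF L(1) that] m by (simp add: m_def)
  then have m_less: "m < coeff (shift_excess \<alpha> M) (Suc M)"
    "i \<le> Suc M \<Longrightarrow> m < coeff (shift_continuant \<alpha> (Suc M)) i" for i
    by (auto simp: L_def simp del: continuant.simps)
  \<comment> \<open>This choice turns the required relation between \<open>m\<close> and
    \<open>\<epsilon>\<close> into an equality.\<close>
  define \<epsilon> where "\<epsilon> = m / (real (Suc M) * R ^ Suc M)"
  have \<epsilon>: "0 < \<epsilon>" using m R by (simp add: \<epsilon>_def)
  have \<epsilon>_m: "real (Suc M) * \<epsilon> * R ^ Suc M \<le> m" using R by (simp add: \<epsilon>_def)
  have "\<forall>\<^sub>F \<beta> in perturbations N \<alpha>. m < coeff (shift_excess \<beta> M) (Suc M)"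
    using m_less by (intro order_tendstoD[OF tendsto_coeff_excess])
  moreover have "\<forall>\<^sub>F \<beta> in perturbations N \<alpha>. \<forall>i\<in>{..Suc M}. m < coeff (shift_continuant \<beta> (Suc M)) i"
    by (intro eventually_ball_finite finite_atMost ballI order_tendstoD[OF tendsto_coeff_continuant])
      (use m_less in auto)
  moreover have "\<forall>\<^sub>F \<beta> in perturbations N \<alpha>. \<forall>i\<in>{..M}. - \<epsilon> < coeff (shift_excess \<beta> M) i"
    using pos \<epsilon> by (intro eventually_ball_finite finite_atMost ballI order_tendstoD[OF tendsto_coeff_excess])
      (meson less_le_trans neg_less_0_iff_less)
  \<comment> \<open>Coefficients above degree \<open>n\<close> vanish identically, so only finitely
    many strict inequalities need to be preserved.\<close>
  moreover have "\<forall>\<^sub>F \<beta> in perturbations N \<alpha>. \<forall>n\<in>{..M}. \<forall>i\<in>{..n}. 0 < coeff (shift_continuant \<beta> n) i"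
    using pos by (intro eventually_ball_finite finite_atMost ballI order_tendstoD[OF tendsto_coeff_continuant]) auto
  moreover have "\<forall>\<^sub>F \<beta> in perturbations N \<alpha>. \<forall>n>N. \<beta> n = \<alpha> n"
    unfolding eventually_perturbations by (intro exI[of _ 1]) auto
  ultimately have "\<forall>\<^sub>F \<beta> in perturbations N \<alpha>. positively_quadratically_hyponormal \<beta>"
  proof eventually_elim
    case (elim \<beta>)
    have u_eq: "ucoef \<beta> n = ucoef \<alpha> n" and z_eq: "zcoef \<beta> n = zcoef \<alpha> n" if "M \<le> n" for n
      using that elim(5) by (auto simp: ucoef_def zcoef_def prev_def M_def)
    have v_eq: "vcoef \<beta> n = vcoef \<alpha> n" if "M < n" for n
      using that elim(5) by (auto simp: vcoef_def prev_def M_def)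
    show ?case
    proof (rule positively_quadratically_hyponormalI,
        rule perturbed_continuant_coeff_nonneg[where M = M and R = R and m = m and \<epsilon> = \<epsilon>, OF _ _ _ _ R(1) _ \<epsilon>_m])
      show "(zcoef \<beta> n)\<^sup>2 \<le> ucoef \<beta> n * vcoef \<beta> (Suc n)" if "M \<le> n" for n
        using p[of n] that by (simp add: u_eq z_eq v_eq)
      show "0 < ucoef \<beta> n" "0 < vcoef \<beta> n" "vcoef \<beta> n \<le> R * ucoef \<beta> n" if "M < n" for n
        using that u v R(2)[of n] by (simp_all add: u_eq v_eq M_def)
      show "0 \<le> coeff (shift_continuant \<beta> n) i" if "n \<le> M" for n i
        using that elim(4) by (cases "i \<le> n") (auto simp: less_imp_le coeff_continuant_eq_0)
      show "m \<le> coeff (shift_continuant \<beta> (Suc M)) i" if "i \<le> Suc M" for i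
        using that elim(2) by (auto simp: less_imp_le simp del: continuant.simps)
      show "- \<epsilon> \<le> coeff (shift_excess \<beta> M) i" if "i \<le> M" for i
        using that elim(3) by (auto simp: less_imp_le)
    qed (use elim(1) \<epsilon> in \<open>auto simp: less_imp_le\<close>)
  qed
  then show "\<exists>\<delta>>0. \<forall>\<alpha>'. (\<forall>n. 0 < \<alpha>' n) \<and> \<alpha>' \<noteq> \<alpha> \<and> (\<forall>n>N. \<alpha>' n = \<alpha> n) \<and>
      (\<forall>n\<le>N. \<bar>\<alpha>' n - \<alpha> n\<bar> < \<delta>) \<longrightarrow> positively_quadratically_hyponormal \<alpha>'"
    unfolding eventually_perturbations by blast
qed

end
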